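(* The public bads allocation rule that returns, on every public bads instance, the set of all strictly positive proportionally fair lotteries satisfies cost consistency, weak symmetry, scale-freeness, and lower contraction consistency.
   Context: A public bads instance $I=(N,A,c)$ consists of agents $N=\{1,\dots,n\}$, a finite set $A$ of alternatives (bads), and cost functions $c_i:A\to\mathbb{R}_{\ge 0}$, $i\in N$. $\Delta(A)$ is the set of lotteries (probability vectors) on $A$; $c_i(x)=\sum_{a\in A}x(a)c_i(a)$ and $c(x)=(c_i(x))_{i\in N}$. Write $\mathcal{C}(I)=\{c(x):x\in\Delta(A)\}$ and $\mathcal{C}_{\ge}(I)=\{z\in\mathbb{R}^N_{\ge0}:\exists z'\in\mathcal{C}(I)\text{ with }z\ge z'\text{ coordinatewise}\}$. Standing assumptions on instances: $0\notin\mathcal{C}(I)$, and for every $i\in N$ there is $a\in A$ with $c_i(a)<\max_{a'\in A}c_i(a')$. $x\in\Delta(A)$ is proportionally fair if $\frac1n\sum_{i\in N}\frac{c_i(y)}{c_i(x)}\ge 1$ for all $y\in\Delta(A)$ (conventions $0/0=1$, $\alpha/0=+\infty$ for $\alpha>0$), and strictly positive if $c_i(x)>0$ for all $i\in N$. A public bads allocation rule $\phi$ maps each instance $I=(N,A,c)$ to a possibly empty set $\phi(I)\subseteq\Delta(A)$; write $c(\phi(I))=\{c(x):x\in\phi(I)\}$. Cost consistency: for any instance $I$ and lotteries $x,x'$ over $I$ with $c_i(x)=c_i(x')$ for all $i\in N$: $x\in\phi(I)$ iff $x'\in\phi(I)$. Weak symmetry: an identity instance is an instance with $n$ agents and $n$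 bads in which for each agent $i$ there is a unique bad $a_i$ with $c_i(a_i)=1$ and $c_{i'}(a_i)=0$ for all $i'\ne i$ (so $A=\{a_1,\dots,a_n\}$). $\phi$ is weakly symmetric if on every identity instance it returns exactly one allocation, the one placing weight $1/n$ on each bad. Scale-freeness: for any instances $I=(N,A,c)$, $I'=(N,A,c')$ such that for some agent $i$ and constant $k>0$ we have $c'_i(a)=k\,c_i(a)$ for all $a\in A$, and $c'_{i'}(a)=c_{i'}(a)$ for all $i'\neq i$ and $a\in A$: $\phi(I)=\phi(I')$. Lower contraction consistency: for any instances $I=(N,A,c)$ and $I'=(N,A',c')$ with $\mathcal{C}_{\ge}(I)\subseteq\mathcal{C}_{\ge}(I')$, we have $c'(\phi(I'))\cap\mathcal{C}(I)\subseteq c(\phi(I))$. *)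

theory Defs
  imports "HOL-Library.Extended_Real" "HOL-Library.FuncSet"
begin

record 'a bads_instance =
  num_agents :: nat
  bads :: "'a set"
  cost :: "nat \<Rightarrow> 'a \<Rightarrow> real"

definition agents :: "'a bads_instance \<Rightarrow> nat set" where
  "agents I = {1..num_agents I}"

definition lotteries :: "'a set \<Rightarrow> ('a \<Rightarrow> real) set" where
  "lotteries A = {x. (\<forall>a. 0 \<le> x a) \<and> (\<forall>a. a \<notin> A \<longrightarrow> x a = 0) \<and> (\<Sum>a\<in>A. x a) = 1}"

definition lottery_cost :: "'a bads_instance \<Rightarrow> ('a \<Rightarrow> real) \<Rightarrow> nat \<Rightarrow> real" where
  "lottery_cost I x i = (\<Sum>a\<in>bads I. x a * cost I i a)"

(* A vector indexed by the set N of agents is an element of N \<rightarrow>\<^sub>E UNIV, i.e. a function that is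
   undefined outside N, so that equality of functions is equality of vectors. *)

definition cost_profile :: "'a bads_instance \<Rightarrow> ('a \<Rightarrow> real) \<Rightarrow> nat \<Rightarrow> real" where
  "cost_profile I x = (\<lambda>i\<in>agents I. lottery_cost I x i)"

definition feasible_costs :: "'a bads_instance \<Rightarrow> (nat \<Rightarrow> real) set" where
  "feasible_costs I = cost_profile I ` lotteries (bads I)"

definition upper_costs :: "'a bads_instance \<Rightarrow> (nat \<Rightarrow> real) set" where
  "upper_costs I =
     {z \<in> agents I \<rightarrow>\<^sub>E {0..}. \<exists>z'\<in>feasible_costs I. \<forall>i\<in>agents I. z i \<ge> z' i}"

(* Cost functions are extensional, so each instance has exactly one representation. *)

definition is_instance :: "'a bads_instance \<Rightarrow> bool" where
  "is_instance I \<longleftrightarrow>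
     num_agents I \<ge> 1 \<and> finite (bads I) \<and>
     cost I \<in> agents I \<rightarrow>\<^sub>E (bads I \<rightarrow>\<^sub>E {0..}) \<and>
     (\<lambda>i\<in>agents I. 0) \<notin> feasible_costs I \<and>
     (\<forall>i\<in>agents I. \<exists>a\<in>bads I. cost I i a < Max (cost I i ` bads I))"

(* Division in ereal has 0 / 0 = 0, whereas here 0 / 0 = 1. *)

definition cost_ratio :: "real \<Rightarrow> real \<Rightarrow> ereal" where
  "cost_ratio u v = (if v = 0 then (if u = 0 then 1 else \<infinity>) else ereal (u / v))"

definition proportionally_fair :: "'a bads_instance \<Rightarrow> ('a \<Rightarrow> real) \<Rightarrow> bool" where
  "proportionally_fair I x \<longleftrightarrow>
     (\<forall>y\<in>lotteries (bads I).
        ereal (1 / real (num_agents I)) *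
          (\<Sum>i\<in>agents I. cost_ratio (lottery_cost I y i) (lottery_cost I x i)) \<ge> 1)"

definition strictly_positive :: "'a bads_instance \<Rightarrow> ('a \<Rightarrow> real) \<Rightarrow> bool" where
  "strictly_positive I x \<longleftrightarrow> (\<forall>i\<in>agents I. lottery_cost I x i > 0)"

(* The values of a rule on records that are not instances are irrelevant: every axiom below
   quantifies over instances only. *)

type_synonym 'a bads_rule = "'a bads_instance \<Rightarrow> ('a \<Rightarrow> real) set"

definition allocation_rule :: "'a bads_rule \<Rightarrow> bool" where
  "allocation_rule \<phi> \<longleftrightarrow> (\<forall>I. is_instance I \<longrightarrow> \<phi> I \<subseteq> lotteries (bads I))"

definition cost_consistent :: "'a bads_rule \<Rightarrow> bool" where
  "cost_consistent \<phi> \<longleftrightarrow>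
     (\<forall>I. is_instance I \<longrightarrow>
        (\<forall>x\<in>lotteries (bads I). \<forall>x'\<in>lotteries (bads I).
           (\<forall>i\<in>agents I. lottery_cost I x i = lottery_cost I x' i) \<longrightarrow>
           (x \<in> \<phi> I \<longleftrightarrow> x' \<in> \<phi> I)))"

definition identity_instance :: "'a bads_instance \<Rightarrow> bool" where
  "identity_instance I \<longleftrightarrow>
     is_instance I \<and> card (bads I) = num_agents I \<and>
     (\<forall>i\<in>agents I. \<exists>!a. a \<in> bads I \<and> cost I i a = 1 \<and>
        (\<forall>i'\<in>agents I. i' \<noteq> i \<longrightarrow> cost I i' a = 0))"

definition weakly_symmetric :: "'a bads_rule \<Rightarrow> bool" where
  "weakly_symmetric \<phi> \<longleftrightarrow>
     (\<forall>I. identity_instance I \<longrightarrow>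
        \<phi> I = {\<lambda>a. if a \<in> bads I then 1 / real (num_agents I) else 0})"

definition scale_free :: "'a bads_rule \<Rightarrow> bool" where
  "scale_free \<phi> \<longleftrightarrow>
     (\<forall>I I' k. \<forall>i\<in>agents I.
        is_instance I \<and> is_instance I' \<and>
        num_agents I' = num_agents I \<and> bads I' = bads I \<and> k > 0 \<and>
        (\<forall>a\<in>bads I. cost I' i a = k * cost I i a) \<and>
        (\<forall>i'\<in>agents I. i' \<noteq> i \<longrightarrow> (\<forall>a\<in>bads I. cost I' i' a = cost I i' a)) \<longrightarrow>
        \<phi> I = \<phi> I')"

definition lower_contraction_consistent :: "'a bads_rule \<Rightarrow> bool" where
  "lower_contraction_consistent \<phi> \<longleftrightarrow>
     (\<forall>I I'.
        is_instance I \<and> is_instance I' \<and> num_agents I' = num_agents I \<and>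
        upper_costs I \<subseteq> upper_costs I' \<longrightarrow>
        cost_profile I' ` \<phi> I' \<inter> feasible_costs I \<subseteq> cost_profile I ` \<phi> I)"

definition spf_rule :: "'a bads_rule" where
  "spf_rule I = {x \<in> lotteries (bads I). strictly_positive I x \<and> proportionally_fair I x}"

end

(* Proportional fairness of a strictly positive x says that sum_i c_i(y)/c_i(x) >= n for all y. This
   condition depends only on cost vectors, is invariant under rescaling any c_i, and is monotone in
   c(y), so the lotteries over I can be replaced by the upper closure of C(I); the latter gives
   lower contraction consistency. On an identity instance, taking y to be a single bad a forces
   x(a) <= 1/n, hence equality as the weights of x sum to 1. *)

theory Submission
  imports Defs
begin

lemma finite_agents [simp]: "finite (agents I)"
  and card_agents [simp]: "card (agents I) = num_agents I"
  by (simp_all add: agents_def)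

lemma agents_cong: "num_agents I = num_agents J \<Longrightarrow> agents I = agents J"
  by (simp add: agents_def)

lemma cost_profile_apply [simp]: "i \<in> agents I \<Longrightarrow> cost_profile I x i = lottery_cost I x i"
  by (simp add: cost_profile_def)

lemma lottery_cost_nonneg:
  assumes "is_instance I" "x \<in> lotteries (bads I)" "i \<in> agents I"
  shows "0 \<le> lottery_cost I x i"
proof -
  have "0 \<le> cost I i a" if "a \<in> bads I" for a
    using assms(1,3) that by (auto simp: is_instance_def PiE_iff)
  then show ?thesis
    using assms(2) by (auto simp: lottery_cost_def lotteries_def intro!: sum_nonneg)
qed

text \<open>The profile dominates itself; nonnegativity of costs puts it in the orthant to which
  \<open>upper_costs\<close> is confined. This lets an inclusion of upper closures act on
  lotteries.\<close>

lemma cost_profile_in_upper_costs: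
  assumes "is_instance I" "x \<in> lotteries (bads I)"
  shows "cost_profile I x \<in> upper_costs I"
  using assms lottery_cost_nonneg
  by (fastforce simp: upper_costs_def feasible_costs_def cost_profile_def)

text \<open>Strict positivity makes every denominator nonzero, so the conventions for 0/0 and
  \<alpha>/0 never apply and the extended-real sum is the embedding of a real one. With at least one
  agent, the factor 1/n can be moved to the other side.\<close>

lemma proportionally_fair_iff:
  assumes "num_agents I \<ge> 1" "strictly_positive I x"
  shows "proportionally_fair I x \<longleftrightarrow>
    (\<forall>y\<in>lotteries (bads I).
       real (num_agents I) \<le> (\<Sum>i\<in>agents I. lottery_cost I y i / lottery_cost I x i))"
proof -
  have "(\<Sum>i\<in>agents I. cost_ratio (lottery_cost I y i) (lottery_cost I x i)) =
      ereal (\<Sum>i\<in>agents I. lottery_cost I y i / lottery_cost I x i)" for y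
  proof -
    have "(\<Sum>i\<in>agents I. cost_ratio (lottery_cost I y i) (lottery_cost I x i)) =
        (\<Sum>i\<in>agents I. ereal (lottery_cost I y i / lottery_cost I x i))"
      using assms(2) by (intro sum.cong) (auto simp: cost_ratio_def strictly_positive_def)
    then show ?thesis
      by simp
  qed
  then show ?thesis
    using assms(1) by (simp add: proportionally_fair_def one_ereal_def field_simps)
qed

text \<open>Each axiom is checked through this real-valued form. Beyond being a lottery,
  \<open>x\<close> enters only through its costs, so cost consistency is immediate.\<close>

lemma mem_spf_rule_iff:
  assumes "is_instance I"
  shows "x \<in> spf_rule I \<longleftrightarrow> x \<in> lotteries (bads I) \<and> (\<forall>i\<in>agents I. 0 < lottery_cost I x i) \<and>
    (\<forall>y\<in>lotteries (bads I).
       real (num_agents I) \<le> (\<Sum>i\<in>agents I. lottery_cost I y i / lottery_cost I x i))"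
  using assms proportionally_fair_iff[of I x]
  by (auto simp: spf_rule_def is_instance_def strictly_positive_def)

lemma allocation_rule_spf: "allocation_rule spf_rule"
  by (auto simp: allocation_rule_def spf_rule_def)

lemma cost_consistent_spf: "cost_consistent spf_rule"
  by (auto simp: cost_consistent_def mem_spf_rule_iff)

lemma scale_free_spf: "scale_free (spf_rule :: 'a bads_rule)"
  unfolding scale_free_def
proof (intro allI ballI impI, elim conjE)
  fix I I' :: "'a bads_instance" and k i
  assume I: "is_instance I" and I': "is_instance I'"
    and n: "num_agents I' = num_agents I" and A: "bads I' = bads I" and k: "0 < k"
    and ci: "\<forall>a\<in>bads I. cost I' i a = k * cost I i a"
    and cj: "\<forall>j\<in>agents I. j \<noteq> i \<longrightarrow> (\<forall>a\<in>bads I. cost I' j a = cost I j a)"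
  \<comment> \<open>By linearity, rescaling agent \<open>i\<close> on bads rescales that agent's
    cost of every lottery.\<close>
  have *: "lottery_cost I' x j = (if j = i then k else 1) * lottery_cost I x j"
    if "j \<in> agents I" for x j
    using that ci cj by (auto simp: lottery_cost_def A sum_distrib_left mult_ac intro!: sum.cong)
  have pos: "(\<forall>j\<in>agents I. 0 < lottery_cost I' x j) \<longleftrightarrow> (\<forall>j\<in>agents I. 0 < lottery_cost I x j)" for x
    using k by (auto simp: * zero_less_mult_iff)
  \<comment> \<open>The factor \<open>k\<close> occurs in both numerator and denominator of the term
    for \<open>i\<close> and cancels.\<close>
  have ratio: "(\<Sum>j\<in>agents I. lottery_cost I' y j / lottery_cost I' x j) =
      (\<Sum>j\<in>agents I. lottery_cost I y j / lottery_cost I x j)" for x y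
    using k by (intro sum.cong) (auto simp: *)
  show "spf_rule I = spf_rule I'"
    by (rule set_eqI)
      (simp add: mem_spf_rule_iff[OF I] mem_spf_rule_iff[OF I'] agents_cong[OF n] n A pos ratio)
qed

lemma lower_contraction_consistent_spf: "lower_contraction_consistent (spf_rule :: 'a bads_rule)"
  unfolding lower_contraction_consistent_def
proof (intro allI impI subsetI, elim conjE)
  fix I I' :: "'a bads_instance" and z
  assume I: "is_instance I" and I': "is_instance I'" and n: "num_agents I' = num_agents I"
    and sub: "upper_costs I \<subseteq> upper_costs I'"
    and z: "z \<in> cost_profile I' ` spf_rule I' \<inter> feasible_costs I"
  note N = agents_cong[OF n]
  from z obtain x' where x': "x' \<in> spf_rule I'" "z = cost_profile I' x'"
    by auto
  from z obtain x where x: "x \<in> lotteries (bads I)" "z = cost_profile I x"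
    by (auto simp: feasible_costs_def)
  have same: "lottery_cost I x i = lottery_cost I' x' i" if "i \<in> agents I" for i
    using x'(2) x(2) that N by (metis cost_profile_apply)
  have pos: "0 < lottery_cost I x i" if "i \<in> agents I" for i
    using x'(1) that by (simp add: mem_spf_rule_iff[OF I'] N same)
  have "real (num_agents I) \<le> (\<Sum>i\<in>agents I. lottery_cost I y i / lottery_cost I x i)"
    if y: "y \<in> lotteries (bads I)" for y
  proof -
    from cost_profile_in_upper_costs[OF I y] sub have "cost_profile I y \<in> upper_costs I'"
      by auto
    \<comment> \<open>The inclusion of upper closures supplies a lottery over \<open>I'\<close> that
      costs no agent more than \<open>y\<close>. Fairness of \<open>x'\<close> is then tested
      against it.\<close>
    then obtain y' where y': "y' \<in> lotteries (bads I')"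
      "\<forall>i\<in>agents I. lottery_cost I' y' i \<le> lottery_cost I y i"
      by (auto simp: upper_costs_def feasible_costs_def N)
    have "real (num_agents I) \<le> (\<Sum>i\<in>agents I. lottery_cost I' y' i / lottery_cost I' x' i)"
      using x'(1) y'(1) by (auto simp: mem_spf_rule_iff[OF I'] N n)
    \<comment> \<open>The denominators agree by \<open>same\<close> and are positive, so the
      termwise comparison reduces to the numerators.\<close>
    also have "\<dots> \<le> (\<Sum>i\<in>agents I. lottery_cost I y i / lottery_cost I x i)"
    proof (rule sum_mono)
      fix i assume "i \<in> agents I"
      with pos y'(2) show "lottery_cost I' y' i / lottery_cost I' x' i
          \<le> lottery_cost I y i / lottery_cost I x i"
        by (simp add: divide_right_mono less_imp_le flip: same)
    qed
    finally show ?thesis .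
  qed
  with x pos have "x \<in> spf_rule I"
    by (simp add: mem_spf_rule_iff[OF I])
  with x(2) show "z \<in> cost_profile I ` spf_rule I"
    by blast
qed

text \<open>Labelling each bad by the one agent it hurts turns costs into weights: an agent's cost
  of a lottery is the probability of that agent's bad. Sums over agents thus become sums over
  bads.\<close>

lemma identity_instance_bij:
  assumes "identity_instance I"
  obtains b where "bij_betw b (agents I) (bads I)"
    and "\<And>x i. i \<in> agents I \<Longrightarrow> lottery_cost I x i = x (b i)"
proof -
  have I: "is_instance I" and card: "card (bads I) = num_agents I"
    using assms by (auto simp: identity_instance_def)
  have fin: "finite (bads I)"
    using I by (simp add: is_instance_def)
  have "\<forall>i\<in>agents I. \<exists>a. a \<in> bads I \<and> cost I i a = 1 \<and>
      (\<forall>j\<in>agents I. j \<noteq> i \<longrightarrow> cost I j a = 0)"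
    using assms unfolding identity_instance_def by blast
  then obtain b where b: "\<And>i. i \<in> agents I \<Longrightarrow> b i \<in> bads I"
      "\<And>i. i \<in> agents I \<Longrightarrow> cost I i (b i) = 1"
      "\<And>i j. i \<in> agents I \<Longrightarrow> j \<in> agents I \<Longrightarrow> j \<noteq> i \<Longrightarrow> cost I j (b i) = 0"
    by metis
  \<comment> \<open>If distinct agents \<open>i\<close> and \<open>j\<close> shared a bad, its cost
    to \<open>j\<close> would be both 1 and 0.\<close>
  have inj: "inj_on b (agents I)"
    by (rule inj_onI) (metis b(2,3) zero_neq_one)
  \<comment> \<open>The image of \<open>b\<close> has as many elements as the finite set
    \<open>bads I\<close> containing it, so \<open>b\<close> is onto.\<close>
  have bij: "bij_betw b (agents I) (bads I)"
    unfolding bij_betw_def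
    using inj b(1) fin card
    by (metis card_agents card_image card_subset_eq image_subsetI)
  have "lottery_cost I x i = x (b i)" if i: "i \<in> agents I" for x i
  proof -
    have "lottery_cost I x i = (\<Sum>j\<in>agents I. x (b j) * cost I i (b j))"
      unfolding lottery_cost_def by (rule sum.reindex_bij_betw[OF bij, symmetric])
    also have "\<dots> = (\<Sum>j\<in>agents I. if i = j then x (b j) else 0)"
      using b i by (intro sum.cong) auto
    finally show ?thesis
      using i by simp
  qed
  with bij show thesis
    by (rule that)
qed

lemma weakly_symmetric_spf: "weakly_symmetric (spf_rule :: 'a bads_rule)"
  unfolding weakly_symmetric_def
proof (intro allI impI)
  fix I :: "'a bads_instance"
  assume id: "identity_instance I"
  then have I: "is_instance I" and card: "card (bads I) = num_agents I"
    by (auto simp: identity_instance_def)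
  have fin: "finite (bads I)" and n: "num_agents I \<ge> 1"
    using I by (auto simp: is_instance_def)
  obtain b where bij: "bij_betw b (agents I) (bads I)"
    and c: "\<And>x i. i \<in> agents I \<Longrightarrow> lottery_cost I x i = x (b i)"
    using identity_instance_bij[OF id] by blast
  define u where "u = (\<lambda>a. if a \<in> bads I then 1 / real (num_agents I) else 0)"
  have pos_iff: "(\<forall>i\<in>agents I. 0 < lottery_cost I x i) \<longleftrightarrow> (\<forall>a\<in>bads I. 0 < x a)" for x
    by (simp add: c flip: bij_betw_imp_surj_on[OF bij])
  have ratio: "(\<Sum>i\<in>agents I. lottery_cost I y i / lottery_cost I x i) = (\<Sum>a\<in>bads I. y a / x a)"
    for x y
    using sum.reindex_bij_betw[OF bij, of "\<lambda>a. y a / x a"] by (simp add: c)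
  have u: "u \<in> lotteries (bads I)"
    using n by (auto simp: lotteries_def u_def card)
  have "u \<in> spf_rule I"
  proof -
    \<comment> \<open>Dividing by the constant weight 1/n multiplies the total mass 1 by n, so
      \<open>u\<close> meets the fairness bound with equality for every \<open>y\<close>.\<close>
    have "(\<Sum>a\<in>bads I. y a / u a) = real (num_agents I)" if "y \<in> lotteries (bads I)" for y
    proof -
      have "(\<Sum>a\<in>bads I. y a / u a) = (\<Sum>a\<in>bads I. y a) * real (num_agents I)"
        by (simp add: u_def sum_distrib_right)
      with that show ?thesis
        by (simp add: lotteries_def)
    qed
    with u n show ?thesis
      unfolding mem_spf_rule_iff[OF I] pos_iff ratio by (simp add: u_def)
  qed
  moreover have "x = u" if x: "x \<in> spf_rule I" for x
  proof -
    have lot: "x \<in> lotteries (bads I)" and pos: "\<forall>a\<in>bads I. 0 < x a"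
      and fair: "\<forall>y\<in>lotteries (bads I). real (num_agents I) \<le> (\<Sum>a\<in>bads I. y a / x a)"
      using x unfolding mem_spf_rule_iff[OF I] pos_iff ratio by auto
    have le: "x a \<le> u a" if a: "a \<in> bads I" for a
    proof -
      \<comment> \<open>Against the lottery concentrated on \<open>a\<close>, fairness reads n \<le>
        1 / \<open>x a\<close>.\<close>
      have "(\<lambda>a'. if a' = a then 1 else 0) \<in> lotteries (bads I)"
        using a fin by (simp add: lotteries_def)
      from bspec[OF fair this]
      have "real (num_agents I) \<le> (\<Sum>a'\<in>bads I. (if a' = a then 1 else 0) / x a')" .
      also have "\<dots> = (\<Sum>a'\<in>bads I. if a' = a then 1 / x a' else 0)"
        by (intro sum.cong) auto
      also have "\<dots> = 1 / x a"
        using a fin by simp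
      finally show ?thesis
        using pos a n by (simp add: u_def field_simps)
    qed
    have "sum x (bads I) = sum u (bads I)"
      using lot u by (simp add: lotteries_def)
    then have "(\<Sum>a\<in>bads I. u a - x a) = 0"
      by (simp add: sum_subtractf)
    \<comment> \<open>By \<open>le\<close> the differences are nonnegative, and they sum to zero, so
      each vanishes.\<close>
    then have eq: "\<forall>a\<in>bads I. u a - x a = 0"
      using le fin by (subst (asm) sum_nonneg_eq_0_iff) auto
    show ?thesis
    proof
      fix a show "x a = u a"
        using eq lot by (cases "a \<in> bads I") (auto simp: lotteries_def u_def)
    qed
  qed
  ultimately show "spf_rule I = {\<lambda>a. if a \<in> bads I then 1 / real (num_agents I) else 0}"
    unfolding u_def by blast
qed

theorem theoremD1:
  shows "allocation_rule (spf_rule :: 'a bads_rule) \<and>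
         cost_consistent (spf_rule :: 'a bads_rule) \<and>
         weakly_symmetric (spf_rule :: 'a bads_rule) \<and>
         scale_free (spf_rule :: 'a bads_rule) \<and>
         lower_contraction_consistent (spf_rule :: 'a bads_rule)"
  using allocation_rule_spf cost_consistent_spf weakly_symmetric_spf scale_free_spf
    lower_contraction_consistent_spf
  by blast

end
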